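(* (Well-balance of the semi-discrete DG scheme.) Let $C_1,C_2$ be positive constants, let $b_h\in\mathcal V_h^k$, and let $U_h=(h_h,m_h,w_h,\eta_h)^T\in(\mathcal V_h^k)^4$ be in the lake-at-rest steady state $$m_h=0,\qquad w_h=0,\qquad \eta_h=C_1h_h,\qquad h_h+b_h=C_2$$ on every element $K\in\mathcal T_h$, so that on every edge $e_K\subset\partial K$ both the interior and the exterior values satisfy $$h_h^{int}+b_h^{int}=C_2,\quad h_h^{ext}+b_h^{ext}=C_2,\quad \eta_h^{int}=C_1h_h^{int},\quad \eta_h^{ext}=C_1h_h^{ext},$$ $$m_h^{int}=m_h^{ext}=0,\qquad w_h^{int}=w_h^{ext}=0 .$$ Then the residual $R^*_{h,K}$ of the hydrostatically reconstructed DG scheme (defined in the context) satisfies $$R^*_{h,K}(U_h,b_h,\phi)=0\qquad\text{for all }K\in\mathcal T_h\text{ and all }\phi\in\mathcal V_h^k ,$$ so that the semi-discrete scheme $\frac{d}{dt}\int_K U_h\phi\,d\mathbf x=R^*_{h,K}(U_h,b_h,\phi)$ gives $\frac{d}{dt}\int_K U_h\phi\,d\mathbf x=0$ for all $K\in\mathcal T_h$, $\phi\in\mathcal V_h^k$. Hence the semi-discrete scheme preserves the lake-at-rest steady-state solution, i.e. it is well-balanced.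
   Context: Ripa model: $\partial_tU+\nabla\cdot F(U)=S(U,b)$ in two space dimensions, $U=(h,m,w,\eta)^T=(h,hu,hv,h\theta)^T$, where $h\ge0$ is the water depth, $(u,v)$ the velocity, $\theta>0$ the potential temperature, $g$ the gravitational acceleration constant, $b$ the bottom topography, $$F(U)=\begin{bmatrix} m&w\\ \frac{m^2}{h}+\frac12 g\eta h&\frac{mw}{h}\\ \frac{mw}{h}&\frac{w^2}{h}+\frac12 g\eta h\\ \frac{m\eta}{h}&\frac{w\eta}{h}\end{bmatrix},\qquad S(U,b)=\begin{bmatrix}0\\-g\eta b_x\\-g\eta b_y\\0\end{bmatrix}.$$ The quotients $m/h$, $w/h$, $\eta/h$, here and below, stand for the velocity components $u,v$ and the temperature $\theta$; in the lake-at-rest state these are $u=0$, $v=0$, $\theta=C_1$. $\mathcal T_h$ is a triangular mesh of a domain $\Omega\subset\mathbb R^2$, $k$ a positive integer, and $\mathcal V_h^k=\{q\in L^2(\Omega): q|_K\in\mathbb P^k(K)\ \forall K\in\mathcal T_h\}$, where $\mathbb P^k(K)$ is the set of polynomials of degree up to $k$ on $K$. The function $b_h$ is the piecewise polynomial approximation of $b$; in $S(U_h,b_h)$ derivatives of $b_h$ are taken elementwise. For an element $K$ with outward unit normal $\mathbf n_K=(n_x,n_y)^T$ and an edge $e_K\subset\partial K$, the superscript $int$ denotes the value on $e_K$ taken from inside $K$; $ext$ denotes the value from the neighbouring element sharing $e_K$ (for an edge on $\partial\Omega$, the exterior value supplied by the boundary treatment). The Lax-Friedrichs flux is $$\hat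 F(U^{int},U^{ext})=\tfrac12\Big(\big(F(U^{int})+F(U^{ext})\big)\cdot\mathbf n_K-\alpha_h(U^{ext}-U^{int})\Big),$$ where $\alpha_h$ is the maximum absolute value of the eigenvalues of the Jacobian matrices of $F(\cdot)\cdot\mathbf n_K$ at the interior and exterior values, taken over the edge or over all elements (the eigenvalues are $un_x+vn_y$ (double) and $un_x+vn_y\pm\sqrt{gh\theta}$). Hydrostatic reconstruction on $e_K$ (pointwise): $$b^*=\max(b_h^{int},b_h^{ext}),\quad h^{int,*}=\max(0,h_h^{int}+b_h^{int}-b^* ),\quad h^{ext,*}=\max(0,h_h^{ext}+b_h^{ext}-b^* ),$$ $$U^{int,*}=h^{int,*}\Big(1,\tfrac{m_h^{int}}{h_h^{int}},\tfrac{w_h^{int}}{h_h^{int}},\tfrac{\eta_h^{int}}{h_h^{int}}\Big)^T,\quad U^{ext,*}=h^{ext,*}\Big(1,\tfrac{m_h^{ext}}{h_h^{ext}},\tfrac{w_h^{ext}}{h_h^{ext}},\tfrac{\eta_h^{ext}}{h_h^{ext}}\Big)^T.$$ The modified flux is $$\hat F^*|_{e_K}=\hat F(U^{int,*},U^{ext,*})+\big(F(U_h^{int})-F(U^{int,*})\big)\cdot\mathbf n_K,$$ and the residual is $$R^*_{h,K}(U_h,b_h,\phi)=\int_KS(U_h,b_h)\phi\,d\mathbf x+\int_KF(U_h)\cdot\nabla\phi\,d\mathbf x-\sum_{e_K\subset\partial K}\int_{e_K}\hat F^*|_{e_K}\,\phi\,ds\ \in\mathbb R^4,$$ where on $e_K$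 the test function $\phi$ takes its value from inside $K$. Integrals are understood exactly. *)

theory Defs
  imports "HOL-Analysis.Analysis"
begin

type_synonym point = "real^2"

text \<open>A conserved state \<open>(h, m, w, \<eta>)\<close>, with components \<open>U $ 1, \<dots>, U $ 4\<close>.\<close>

type_synonym state = "real^4"

text \<open>
  Functions defined elementwise: \<open>q K\<close> is the representative of the restriction of \<open>q\<close> to the
  element \<open>K\<close>.  On an edge shared by two elements \<open>K\<close> and \<open>K'\<close>, the two
  traces are \<open>q K\<close> and \<open>q K'\<close>; they need not agree.
\<close>

type_synonym 'a field = "point set \<Rightarrow> point \<Rightarrow> 'a"

lemma vector_4:
  "(vector [a, b, c, d] :: 'a::zero^4) $ 1 = a"
  "(vector [a, b, c, d] :: 'a::zero^4) $ 2 = b"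
  "(vector [a, b, c, d] :: 'a::zero^4) $ 3 = c"
  "(vector [a, b, c, d] :: 'a::zero^4) $ 4 = d"
  unfolding vector_def by simp_all


section \<open>Mesh and discontinuous piecewise polynomial space\<close>

text \<open>
  The clause on faces in \<^const>\<open>triangulation\<close> makes the mesh conforming.  Elements are closed
  nondegenerate triangles.
\<close>

definition triangular_mesh :: "point set set \<Rightarrow> point set \<Rightarrow> bool" where
  "triangular_mesh \<T> \<Omega> \<longleftrightarrow>
     open \<Omega> \<and> connected \<Omega> \<and> \<Omega> \<noteq> {} \<and>
     triangulation \<T> \<and> (\<forall>K\<in>\<T>. 2 simplex K) \<and> \<Union>\<T> = closure \<Omega>"

definition edges :: "point set \<Rightarrow> point set set" where
  "edges K = {e. e edge_of K}"

definition neighbour :: "point set set \<Rightarrow> point set \<Rightarrow> point set \<Rightarrow> point set" where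
  "neighbour \<T> K e = (SOME K'. K' \<in> \<T> \<and> K' \<noteq> K \<and> e edge_of K')"

text \<open>
  The condition says that \<open>K\<close> lies in the half plane bounded by the line through \<open>e\<close> and
  opposite to \<open>n\<close>; taking \<open>y\<close> in \<open>e\<close> shows that \<open>n\<close> is orthogonal to \<open>e\<close>.
\<close>

definition outward_normal :: "point set \<Rightarrow> point set \<Rightarrow> point" where
  "outward_normal K e = (THE n. norm n = 1 \<and> (\<forall>x\<in>e. \<forall>y\<in>K. n \<bullet> y \<le> n \<bullet> x))"

text \<open>Integral with respect to arc length; it does not depend on the orientation chosen.\<close>

definition edge_integral :: "point set \<Rightarrow> (point \<Rightarrow> 'a::real_normed_vector) \<Rightarrow> 'a" where
  "edge_integral e f =
     (let (p, q) = (SOME (p, q). e = closed_segment p q)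
      in dist p q *\<^sub>R integral {0..1} (\<lambda>t. f (linepath p q t)))"

definition polys :: "nat \<Rightarrow> (point \<Rightarrow> real) set" where
  "polys k = {p. \<exists>c :: nat \<Rightarrow> nat \<Rightarrow> real.
     \<forall>x. p x = (\<Sum>i\<le>k. \<Sum>j\<le>k - i. c i j * (x $ 1) ^ i * (x $ 2) ^ j)}"

text \<open>
  A polynomial on an element is identified with its unique polynomial extension to the plane, so
  traces and elementwise derivatives are those of \<open>q K\<close>.  Square integrability is automatic
  since the mesh is finite and its elements are compact.
\<close>

definition dg_space :: "nat \<Rightarrow> point set set \<Rightarrow> real field set" where
  "dg_space k \<T> = {q. \<forall>K\<in>\<T>. q K \<in> polys k}"

definition dg_states :: "nat \<Rightarrow> point set set \<Rightarrow> state field set" where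
  "dg_states k \<T> = {U. \<forall>i. (\<lambda>K x. U K x $ i) \<in> dg_space k \<T>}"

definition grad :: "(point \<Rightarrow> real) \<Rightarrow> point \<Rightarrow> real^2" where
  "grad q x = (\<chi> i. frechet_derivative q (at x) (axis i 1))"


section \<open>The Ripa model\<close>

datatype speed_range = Over_Edge | Over_All_Elements

text \<open>
  \<open>dry_temp\<close> is the value that the quotient \<open>\<eta> / h\<close> stands for where \<open>h = 0\<close>;
  there the velocity quotients are \<open>0\<close>, which is the convention \<open>x / 0 = 0\<close>.
  \<open>bdry_state\<close> and \<open>bdry_bottom\<close> are the exterior values supplied by
  the boundary treatment on edges \<open>e\<close> of \<open>K\<close> contained in the boundary of the domain;
  the exterior state may depend on the whole discrete solution.
\<close>

record setting =
  gravity :: real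
  dry_temp :: real
  speed_range :: speed_range
  region :: "point set"
  mesh :: "point set set"
  bdry_state :: "state field \<Rightarrow> point set \<Rightarrow> point set \<Rightarrow> point \<Rightarrow> state"
  bdry_bottom :: "point set \<Rightarrow> point set \<Rightarrow> point \<Rightarrow> real"

definition vel_u :: "state \<Rightarrow> real" where
  "vel_u U = U $ 2 / U $ 1"

definition vel_v :: "state \<Rightarrow> real" where
  "vel_v U = U $ 3 / U $ 1"

definition temp :: "setting \<Rightarrow> state \<Rightarrow> real" where
  "temp D U = (if U $ 1 = 0 then dry_temp D else U $ 4 / U $ 1)"

definition flux :: "setting \<Rightarrow> state \<Rightarrow> real^2^4" where
  "flux D U =
     (let h = U $ 1; m = U $ 2; w = U $ 3; \<eta> = U $ 4;
          u = vel_u U; v = vel_v U; \<theta> = temp D U; g = gravity D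
      in vector [vector [m, w],
                 vector [m * u + 1/2 * g * \<eta> * h, m * v],
                 vector [m * v, w * v + 1/2 * g * \<eta> * h],
                 vector [m * \<theta>, w * \<theta>]])"

text \<open>The second argument is the gradient of the bottom.\<close>

definition source :: "setting \<Rightarrow> state \<Rightarrow> real^2 \<Rightarrow> state" where
  "source D U db = vector [0, - gravity D * U $ 4 * db $ 1, - gravity D * U $ 4 * db $ 2, 0]"

text \<open>
  Eigenvalues of the Jacobian of \<open>\<lambda>U. F U \<cdot> n\<close>, also used where \<open>h = 0\<close> and the
  quotients in \<open>F\<close> are not differentiable; see \<open>jacobian_eigenvalues\<close> below for \<open>h > 0\<close>.
\<close>

definition eigenvalues :: "setting \<Rightarrow> real^2 \<Rightarrow> state \<Rightarrow> real set" where
  "eigenvalues D n U =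
     (let un = vel_u U * n $ 1 + vel_v U * n $ 2; c = sqrt (gravity D * U $ 1 * temp D U)
      in {un, un + c, un - c})"

lemma jacobian_eigenvalues_aux:
  fixes u v T h g nx ny :: real
  assumes nn: "nx^2 + ny^2 = 1" and c: "g * h * T \<ge> 0"
  defines "J \<equiv> (vector
   [vector [0, nx, ny, 0],
    vector [- u * (u * nx+v * ny) + 1/2 * g * T * h * nx, (u * nx+v * ny) + u * nx, u * ny, 1/2 * g * h * nx],
    vector [- v * (u * nx+v * ny) + 1/2 * g * T * h * ny, v * nx, (u * nx+v * ny) + v * ny, 1/2 * g * h * ny],
    vector [- T * (u * nx+v * ny), T * nx, T * ny, u * nx+v * ny]] :: real^4^4)"
  shows "{l. \<exists>V. V \<noteq> 0 \<and> J *v V = l *\<^sub>R V} =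
     {u * nx+v * ny, u * nx+v * ny + sqrt (g * h * T), u * nx+v * ny - sqrt (g * h * T)}"
proof -
  define un where "un = u * nx+v * ny"
  have J: "J *v V = l *\<^sub>R V \<longleftrightarrow>
     nx * V$2 + ny * V$3 = l * V$1 \<and>
     (- u * un + 1/2 * g * T * h * nx) * V$1 + (un + u * nx) * V$2 + u * ny * V$3 + 1/2 * g * h * nx * V$4 = l * V$2 \<and>
     (- v * un + 1/2 * g * T * h * ny) * V$1 + v * nx * V$2 + (un + v * ny) * V$3 + 1/2 * g * h * ny * V$4 = l * V$3 \<and>
     (- T * un) * V$1 + T * nx * V$2 + T * ny * V$3 + un * V$4 = l * V$4" for V l
    by (simp add: vec_eq_iff forall_4 matrix_vector_mult_def sum_4 J_def vector_4 un_def)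
  have cc: "sqrt (g * h * T) ^ 2 = g * h * T" using c by simp
  have "(\<exists>V. V \<noteq> 0 \<and> J *v V = l *\<^sub>R V) \<longleftrightarrow> l - un = 0 \<or> (l - un)^2 = g * h * T" for l
  proof
    assume "\<exists>V. V \<noteq> 0 \<and> J *v V = l *\<^sub>R V"
    then obtain V where V0: "V \<noteq> 0" and E: "J *v V = l *\<^sub>R V" by blast
    define a p q r z s where "a = V$1" and "p = V$2" and "q = V$3" and "r = V$4"
      and "z = l - un" and "s = p * nx + q * ny - un * a"
    note E' = E[unfolded J, folded a_def p_def q_def r_def]
    have s': "u * s = u * (p * nx + q * ny) - u * un * a" "v * s = v * (p * nx + q * ny) - v * un * a"
      "T * s = T * (p * nx + q * ny) - T * un * a"
      by (simp_all add: s_def algebra_simps)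
    have e1: "s = z * a" and e2: "u * s + nx * (1/2 * g * h * (T * a+r)) = z * p"
      and e3: "v * s + ny * (1/2 * g * h * (T * a+r)) = z * q" and e4: "T * s = z * r"
      using E'[THEN conjunct1] E'[THEN conjunct2, THEN conjunct1]
        E'[THEN conjunct2, THEN conjunct2, THEN conjunct1]
        E'[THEN conjunct2, THEN conjunct2, THEN conjunct2]
      unfolding s' unfolding s_def z_def by argo+
    have "nx * (u * s + nx * (1/2 * g * h * (T * a+r))) + ny * (v * s + ny * (1/2 * g * h * (T * a+r))) = z * (p * nx+q * ny)"
      unfolding e2 e3 by (simp add: algebra_simps)
    moreover have "nx * (u * s + nx * (1/2 * g * h * (T * a+r))) + ny * (v * s + ny * (1/2 * g * h * (T * a+r)))
        = un * s + (nx^2+ny^2) * (1/2 * g * h * (T * a+r))"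
      unfolding un_def by (simp add: field_simps power2_eq_square)
    moreover have "z * (p * nx + q * ny) = z * s + un * s"
      using e1 by (simp add: s_def algebra_simps)
    ultimately have e5: "1/2 * g * h * (T * a + r) = z * s"
      using nn by simp
    show "l - un = 0 \<or> (l - un)^2 = g * h * T"
    proof (rule ccontr)
      assume "\<not> ?thesis"
      then have z: "z \<noteq> 0" "z^2 \<noteq> g * h * T" unfolding z_def by auto
      have r: "r = T * a" using e4 e1 z(1) by simp
      have "g * h * T * a = z^2 * a" using e5 e1 r by (auto simp: power2_eq_square mult.assoc)
      then have a: "a = 0" using z(2) by simp
      then have "s = 0" "r = 0" using e1 r by auto
      then have "p = 0" "q = 0" using e2 e3 a z(1) by auto
      with a \<open>r = 0\<close> have "V = 0" by (simp add: vec_eq_iff forall_4 a_def p_def q_def r_def)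
      with V0 show False by simp
    qed
  next
    assume "l - un = 0 \<or> (l - un)^2 = g * h * T"
    then show "\<exists>V. V \<noteq> 0 \<and> J *v V = l *\<^sub>R V"
    proof
      assume "l - un = 0"
      then have "J *v vector [0,-ny,nx,0] = l *\<^sub>R vector [0,-ny,nx,0]"
        unfolding J vector_4 by (simp add: algebra_simps)
      moreover have "(vector [0,-ny,nx,0] :: real^4) \<noteq> 0"
        using nn by (auto simp: vec_eq_iff forall_4 vector_4)
      ultimately show ?thesis by blast
    next
      assume z: "(l - un)^2 = g * h * T"
      define z where "z = l - un"
      have l: "l = un + z" and zz: "g * h * T = z * z"
        using z by (simp_all add: z_def power2_eq_square)
      have 1: "nx * (u+z * nx) + ny * (v+z * ny) = l"
        using nn unfolding l un_def by algebra
      have "J *v vector [1,u+z * nx,v+z * ny,T] = l *\<^sub>R vector [1,u+z * nx,v+z * ny,T]"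
        unfolding J vector_4 using nn zz unfolding l un_def by (intro conjI; algebra)
      moreover have "(vector [1,u+z * nx,v+z * ny,T] :: real^4) \<noteq> 0"
        by (auto simp: vec_eq_iff forall_4 vector_4)
      ultimately show ?thesis by blast
    qed
  qed
  moreover have "(l - un)^2 = g * h * T \<longleftrightarrow> l = un + sqrt (g * h * T) \<or> l = un - sqrt (g * h * T)" for l
    using power2_eq_iff[of "l - un" "sqrt (g * h * T)"] unfolding cc by auto
  ultimately show ?thesis unfolding un_def[symmetric] by auto
qed

lemma jacobian_eigenvalues:
  assumes h: "U $ 1 > 0" and n: "norm n = 1" and c: "gravity D * U $ 1 * temp D U \<ge> 0"
  shows "\<exists>J :: real^4^4. ((\<lambda>V. flux D V *v n) has_derivative (\<lambda>V. J *v V)) (at U) \<and>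
           {l. \<exists>V. V \<noteq> 0 \<and> J *v V = l *\<^sub>R V} = eigenvalues D n U"
proof -
  define nx ny u v T g where "nx = n$1" and "ny = n$2" and "u = vel_u U" and "v = vel_v U"
    and "T = temp D U" and "g = gravity D"
  define J where "J = (vector
   [vector [0, nx, ny, 0],
    vector [- u * (u * nx+v * ny) + 1/2 * g * T * U$1 * nx, (u * nx+v * ny) + u * nx, u * ny, 1/2 * g * U$1 * nx],
    vector [- v * (u * nx+v * ny) + 1/2 * g * T * U$1 * ny, v * nx, (u * nx+v * ny) + v * ny, 1/2 * g * U$1 * ny],
    vector [- T * (u * nx+v * ny), T * nx, T * ny, u * nx+v * ny]] :: real^4^4)"
  have nn: "nx^2 + ny^2 = 1"
    using n unfolding nx_def ny_def norm_eq_1 inner_vec_def by (simp add: sum_2 power2_eq_square)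
  have U: "U$2 = u * U$1" "U$3 = v * U$1" "U$4 = T * U$1"
    using h by (simp_all add: u_def v_def T_def vel_u_def vel_v_def temp_def)
  define G :: "state \<Rightarrow> state" where "G = (\<lambda>V. vector
    [V$2 * nx + V$3 * ny,
     (V$2 * V$2/V$1 + 1/2 * g * V$4 * V$1) * nx + V$2 * V$3/V$1 * ny,
     V$2 * V$3/V$1 * nx + (V$3 * V$3/V$1 + 1/2 * g * V$4 * V$1) * ny,
     V$2 * V$4/V$1 * nx + V$3 * V$4/V$1 * ny])"
  have G: "flux D V *v n = G V" if "V$1 > 0" for V
    using that by (simp add: vec_eq_iff forall_4 G_def flux_def Let_def matrix_vector_mult_def sum_2
       vector_4 vel_u_def vel_v_def temp_def nx_def ny_def g_def field_simps)
  have "((\<lambda>V. G V $ i) has_derivative (\<lambda>V. (J *v V) $ i)) (at U)" for i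
  proof -
    have "\<forall>i. ((\<lambda>V. G V $ i) has_derivative (\<lambda>V. (J *v V) $ i)) (at U)"
      unfolding forall_4 G_def vector_4
      using h
      by (intro conjI; (auto intro!: derivative_eq_intros bounded_linear.has_derivative[OF bounded_linear_vec_nth] simp: U J_def matrix_vector_mult_def sum_4 vector_4 field_simps fun_eq_iff)[1])
    then show ?thesis by blast
  qed
  then have "(G has_derivative (\<lambda>V. J *v V)) (at U)"
    by (subst has_derivative_componentwise_within) (auto simp: Basis_vec_def inner_axis)
  then have "((\<lambda>V. flux D V *v n) has_derivative (\<lambda>V. J *v V)) (at U)"
    by (rule has_derivative_transform_within_open[where s="{V. V$1 > 0}"])
       (use h G in \<open>auto intro!: open_Collect_less continuous_intros\<close>)
  moreover have "{l. \<exists>V. V \<noteq> 0 \<and> J *v V = l *\<^sub>R V} = eigenvalues D n U"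
    unfolding J_def using jacobian_eigenvalues_aux[OF nn, of g "U$1" T u v] c
    by (simp add: eigenvalues_def Let_def g_def T_def u_def v_def nx_def ny_def)
  ultimately show ?thesis by blast
qed


section \<open>The hydrostatically reconstructed scheme\<close>

definition state_ext :: "setting \<Rightarrow> state field \<Rightarrow> point set \<Rightarrow> point set \<Rightarrow> point \<Rightarrow> state" where
  "state_ext D U K e x =
     (if e \<subseteq> frontier (region D) then bdry_state D U K e x else U (neighbour (mesh D) K e) x)"

definition bottom_ext :: "setting \<Rightarrow> real field \<Rightarrow> point set \<Rightarrow> point set \<Rightarrow> point \<Rightarrow> real" where
  "bottom_ext D b K e x =
     (if e \<subseteq> frontier (region D) then bdry_bottom D K e x else b (neighbour (mesh D) K e) x)"

definition reconstruct :: "setting \<Rightarrow> real \<Rightarrow> real \<Rightarrow> state \<Rightarrow> state" where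
  "reconstruct D b_star b U =
     max 0 (U $ 1 + b - b_star) *\<^sub>R vector [1, vel_u U, vel_v U, temp D U]"

definition bottom_star :: "setting \<Rightarrow> real field \<Rightarrow> point set \<Rightarrow> point set \<Rightarrow> point \<Rightarrow> real" where
  "bottom_star D b K e x = max (b K x) (bottom_ext D b K e x)"

definition state_int_star ::
    "setting \<Rightarrow> state field \<Rightarrow> real field \<Rightarrow> point set \<Rightarrow> point set \<Rightarrow> point \<Rightarrow> state" where
  "state_int_star D U b K e x = reconstruct D (bottom_star D b K e x) (b K x) (U K x)"

definition state_ext_star ::
    "setting \<Rightarrow> state field \<Rightarrow> real field \<Rightarrow> point set \<Rightarrow> point set \<Rightarrow> point \<Rightarrow> state" where
  "state_ext_star D U b K e x =
     reconstruct D (bottom_star D b K e x) (bottom_ext D b K e x) (state_ext D U K e x)"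

definition edge_eigenvalues ::
    "setting \<Rightarrow> state field \<Rightarrow> real field \<Rightarrow> point set \<Rightarrow> point set \<Rightarrow> real set" where
  "edge_eigenvalues D U b K e =
     (\<Union>x\<in>e. eigenvalues D (outward_normal K e) (state_int_star D U b K e x) \<union>
            eigenvalues D (outward_normal K e) (state_ext_star D U b K e x))"

text \<open>
  Taken at the values to which the Lax-Friedrichs flux is applied, that is, the reconstructed ones.
\<close>

definition alpha :: "setting \<Rightarrow> state field \<Rightarrow> real field \<Rightarrow> point set \<Rightarrow> point set \<Rightarrow> real" where
  "alpha D U b K e =
     (case speed_range D of
        Over_Edge \<Rightarrow> (SUP l\<in>edge_eigenvalues D U b K e. \<bar>l\<bar>)
      | Over_All_Elements \<Rightarrow>
          (SUP l\<in>(\<Union>K'\<in>mesh D. \<Union>e'\<in>edges K'. edge_eigenvalues D U b K' e'). \<bar>l\<bar>))"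

definition lax_friedrichs :: "setting \<Rightarrow> real \<Rightarrow> real^2 \<Rightarrow> state \<Rightarrow> state \<Rightarrow> state" where
  "lax_friedrichs D \<alpha> n U_int U_ext =
     (1/2) *\<^sub>R ((flux D U_int + flux D U_ext) *v n - \<alpha> *\<^sub>R (U_ext - U_int))"

definition modified_flux ::
    "setting \<Rightarrow> state field \<Rightarrow> real field \<Rightarrow> point set \<Rightarrow> point set \<Rightarrow> point \<Rightarrow> state" where
  "modified_flux D U b K e x =
     lax_friedrichs D (alpha D U b K e) (outward_normal K e)
       (state_int_star D U b K e x) (state_ext_star D U b K e x)
     + (flux D (U K x) - flux D (state_int_star D U b K e x)) *v outward_normal K e"

definition residual ::
    "setting \<Rightarrow> state field \<Rightarrow> real field \<Rightarrow> real field \<Rightarrow> point set \<Rightarrow> state" where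
  "residual D U b \<phi> K =
     integral K (\<lambda>x. \<phi> K x *\<^sub>R source D (U K x) (grad (b K) x))
     + integral K (\<lambda>x. flux D (U K x) *v grad (\<phi> K) x)
     - (\<Sum>e\<in>edges K. edge_integral e (\<lambda>x. \<phi> K x *\<^sub>R modified_flux D U b K e x))"

definition semidiscrete_solution ::
    "setting \<Rightarrow> nat \<Rightarrow> real field \<Rightarrow> real set \<Rightarrow> (real \<Rightarrow> state field) \<Rightarrow> bool" where
  "semidiscrete_solution D k b I V \<longleftrightarrow>
     (\<forall>t\<in>I. V t \<in> dg_states k (mesh D)) \<and>
     (\<forall>t\<in>I. \<forall>K\<in>mesh D. \<forall>\<phi>\<in>dg_space k (mesh D).
        ((\<lambda>s. integral K (\<lambda>x. \<phi> K x *\<^sub>R V s K x))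
           has_vector_derivative residual D (V t) b \<phi> K) (at t within I))"


section \<open>Lake at rest\<close>

text \<open>Relation between a state and a bottom value at one point.\<close>

definition at_rest :: "real \<Rightarrow> real \<Rightarrow> state \<Rightarrow> real \<Rightarrow> bool" where
  "at_rest C1 C2 U b \<longleftrightarrow> U $ 2 = 0 \<and> U $ 3 = 0 \<and> U $ 4 = C1 * U $ 1 \<and> U $ 1 + b = C2"

definition lake_at_rest ::
    "setting \<Rightarrow> real \<Rightarrow> real \<Rightarrow> state field \<Rightarrow> real field \<Rightarrow> bool" where
  "lake_at_rest D C1 C2 U b \<longleftrightarrow> (\<forall>K\<in>mesh D. \<forall>x\<in>K. at_rest C1 C2 (U K x) (b K x))"

definition boundary_at_rest :: "setting \<Rightarrow> real \<Rightarrow> real \<Rightarrow> state field \<Rightarrow> bool" where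
  "boundary_at_rest D C1 C2 U \<longleftrightarrow>
     (\<forall>K\<in>mesh D. \<forall>e\<in>edges K. e \<subseteq> frontier (region D) \<longrightarrow>
        (\<forall>x\<in>e. at_rest C1 C2 (bdry_state D U K e x) (bdry_bottom D K e x)))"

end

theory Submission
  imports Defs
begin

text \<open>
  At rest every quotient in the flux vanishes, so the flux reduces to the hydrostatic pressure
  \<open>p = 1/2 * g * C1 * h^2\<close> acting in the two momentum components. Since
  \<open>h + b = C2\<close> on an element, \<open>p\<close> is the polynomial \<open>1/2 * g * C1 * (C2 - b)^2\<close> there, and the
  source \<open>- g * C1 * h * grad b\<close> is exactly \<open>grad p\<close>.

  On an edge the two reconstructed depths are both \<open>max 0 (C2 - b_star)\<close>, so the two
  reconstructed states coincide (\<open>reconstruct_at_rest\<close>). The Lax-Friedrichs dissipation then vanishes, whatever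
  \<open>\<alpha>\<close> is, and consistency leaves the physical flux of the interior state
  (\<open>modified_flux_at_rest\<close>), that is, \<open>p\<close> times the normal. This requires the exterior value to be at
  rest also, which for an edge not contained in the boundary means that the chosen neighbour
  really is another mesh element sharing the edge (\<open>neighbour_shares_edge\<close>).

  The residual is therefore the difference of the two sides of
  \<open>\<integral> \<phi> grad p + p grad \<phi> = \<Sum> \<integral> \<phi> p n\<close>, the gradient theorem for the polynomial \<open>\<phi> p\<close> on a triangle
  (\<open>gradient_theorem_triangle\<close>). That theorem follows by mapping the reference triangle
  affinely onto \<open>K\<close>: the derivative along a side becomes a coordinate derivative, which Fubini's theorem
  and the fundamental theorem of calculus integrate to a difference of two edge integrals. Two
  sides of \<open>K\<close> span the plane, so these two scalar identities determine the vector identity.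
\<close>

section \<open>Directional derivatives integrated over a triangle\<close>

lemma continuous_on_vector_2:
  fixes p q :: "'a::t2_space \<Rightarrow> real"
  assumes "continuous_on S p" "continuous_on S q"
  shows "continuous_on S (\<lambda>x. vector [p x, q x] :: real^2)"
  using assms by (subst continuous_on_componentwise) (auto simp: Basis_vec_def inner_axis forall_2)

text \<open>
  Fubini's theorem is about product measures; this identification carries it to \<open>real^2\<close>, where the
  affine change of variables lives.
\<close>

lemma lborel_vec2: "lborel = distr (lborel :: (real\<times>real) measure) borel (\<lambda>(s, t). vector [s, t] :: real^2)"
proof (rule lborel_eqI)
  have J: "continuous_on UNIV (\<lambda>(s, t). vector [s, t] :: real^2)"
    unfolding case_prod_beta by (intro continuous_on_vector_2 continuous_intros)
  then have [measurable]: "(\<lambda>(s, t). vector [s, t] :: real^2) \<in> borel \<rightarrow>\<^sub>M borel"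
    by (rule borel_measurable_continuous_onI)
  fix l u :: "real^2"
  assume "\<And>b. b \<in> Basis \<Longrightarrow> l \<bullet> b \<le> u \<bullet> b"
  then have le: "l $ 1 \<le> u $ 1" "l $ 2 \<le> u $ 2"
    by (auto simp: Basis_vec_def inner_axis' intro: axis_in_Basis_iff[THEN iffD2]) (metis cart_eq_inner_axis)+
  have "(\<lambda>(s, t). vector [s, t] :: real^2) -` box l u = box (l $ 1, l $ 2) (u $ 1, u $ 2)"
  proof -
    have "(s, t) \<in> box (l $ 1, l $ 2) (u $ 1, u $ 2) \<longleftrightarrow> l $ 1 < s \<and> s < u $ 1 \<and> l $ 2 < t \<and> t < u $ 2" for s t
      by (auto simp: box_def Basis_prod_def)
    then show ?thesis
      by (auto simp: mem_box_cart forall_2)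
  qed
  then show "emeasure (distr lborel borel (\<lambda>(s, t). vector [s, t])) (box l u) = (\<Prod>b\<in>Basis. (u - l) \<bullet> b)"
    using le by (simp add: emeasure_distr emeasure_lborel_box_eq Basis_prod_def Basis_vec_def inner_axis
      UNIV_2 axis_eq_axis prod.union_disjoint)
qed simp

definition std_triangle :: "(real^2) set" where
  "std_triangle = {x. 0 \<le> x $ 1 \<and> 0 \<le> x $ 2 \<and> x $ 1 + x $ 2 \<le> 1}"

lemma compact_std_triangle: "compact std_triangle"
proof -
  have "closed std_triangle"
    unfolding std_triangle_def
    by (intro closed_Collect_conj closed_Collect_le continuous_on_add continuous_on_component
        continuous_on_const continuous_on_id)
  moreover have "std_triangle \<subseteq> cbox 0 1"
    by (auto simp: std_triangle_def mem_box_cart forall_2)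
  ultimately show ?thesis
    unfolding compact_eq_bounded_closed using bounded_subset[OF bounded_cbox] by simp
qed

lemma absolutely_integrable_continuous_compact:
  fixes f :: "'a::euclidean_space \<Rightarrow> 'b::euclidean_space"
  assumes "compact S" "continuous_on S f"
  shows "f absolutely_integrable_on S"
  using borel_integrable_compact[OF assms]
  by (simp add: integrable_completion set_integrable_def)

text \<open>
  \<open>F\<close> is the partial derivative of \<open>f\<close> in the first coordinate. Each horizontal slice of the
  triangle is an interval, over which \<open>F\<close> integrates to a difference of end point values; these end
  points trace the hypotenuse and the vertical leg. The partial derivative in the second coordinate
  reduces to this case when the vertices of the image triangle are relabelled.
\<close>

lemma integral_std_triangle:
  fixes F f :: "real^2 \<Rightarrow> real"
  assumes F: "continuous_on UNIV F"
    and f: "\<And>s t. ((\<lambda>s. f (vector [s, t])) has_real_derivative F (vector [s, t])) (at s)"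
    and cf: "continuous_on UNIV f"
  shows "integral std_triangle F =
    integral {0..1} (\<lambda>t. f (vector [1 - t, t]) - f (vector [0, t]))"
proof -
  let ?J = "\<lambda>(s, t). vector [s, t] :: real^2"
  have cJ: "continuous_on UNIV ?J"
    unfolding case_prod_beta by (intro continuous_on_vector_2 continuous_intros)
  then have [measurable]: "?J \<in> borel \<rightarrow>\<^sub>M borel"
    by (rule borel_measurable_continuous_onI)
  let ?h = "\<lambda>x. indicator std_triangle x *\<^sub>R F x"
  have int: "integrable lborel ?h"
    by (rule borel_integrable_compact[OF compact_std_triangle continuous_on_subset[OF F]]) simp
  then have hm: "?h \<in> borel_measurable borel"
    using borel_measurable_integrable by fastforce
  have intJ: "integrable lborel (\<lambda>z. ?h (?J z))"
    using int hm unfolding lborel_vec2 by (subst (asm) integrable_distr_eq) auto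
  have "integral std_triangle F = (LINT x : std_triangle | lborel. F x)"
    using int by (intro set_borel_integral_eq_integral(2)[symmetric]) (simp add: set_integrable_def)
  also have "\<dots> = (LINT z | lborel. ?h (?J z))"
    unfolding set_lebesgue_integral_def using hm
    by (subst lborel_vec2, subst integral_distr) auto
  also have "\<dots> = (LINT t | lborel. LINT s | lborel. ?h (vector [s, t]))"
    using lborel_pair.integral_snd[of "\<lambda>s t. ?h (vector [s, t])"] intJ
    by (simp add: lborel_prod case_prod_beta')
  also have "\<dots> = (LINT t | lborel. indicator {0..1} t *\<^sub>R (f (vector [1 - t, t]) - f (vector [0, t])))"
  proof (rule arg_cong[where f="integral\<^sup>L lborel"], rule ext)
    fix t :: real
    show "(LINT s | lborel. ?h (vector [s, t])) =
        indicator {0..1} t *\<^sub>R (f (vector [1 - t, t]) - f (vector [0, t]))"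
    proof (cases "t \<in> {0..1}")
      case True
      then have "(\<lambda>s. ?h (vector [s, t])) = (\<lambda>s. indicator {0..1 - t} s *\<^sub>R F (vector [s, t]))"
        by (auto simp: std_triangle_def indicator_def fun_eq_iff)
      moreover have "(LINT s | lborel. indicator {0..1 - t} s *\<^sub>R F (vector [s, t])) =
          f (vector [1 - t, t]) - f (vector [0, t])"
        using True f continuous_on_compose2[OF F continuous_on_vector_2[of UNIV "\<lambda>s. s" "\<lambda>s. t"]]
        by (intro integral_FTC_atLeastAtMost)
           (auto intro: continuous_on_subset has_field_derivative_at_within
             simp: has_real_derivative_iff_has_vector_derivative[symmetric])
      ultimately show ?thesis
        using True by simp
    next
      case False
      then have "(\<lambda>s. ?h (vector [s, t])) = (\<lambda>s. 0)"
        by (auto simp: std_triangle_def indicator_def fun_eq_iff)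
      with False show ?thesis by simp
    qed
  qed
  also have "\<dots> = integral {0..1} (\<lambda>t. f (vector [1 - t, t]) - f (vector [0, t]))"
  proof -
    have cft: "continuous_on UNIV (\<lambda>t. f (vector [p t, t]))" if "continuous_on UNIV p" for p :: "real \<Rightarrow> real"
      by (rule continuous_on_compose2[OF cf continuous_on_vector_2[OF that continuous_on_id]]) simp
    have "continuous_on UNIV (\<lambda>t. f (vector [1 - t, t]) - f (vector [0, t]))"
      by (intro continuous_on_diff cft continuous_on_const continuous_on_id)
    then have "set_integrable lborel {0..1} (\<lambda>t. f (vector [1 - t, t]) - f (vector [0, t]))"
      unfolding set_integrable_def
      by (intro borel_integrable_compact) (auto intro: continuous_on_subset)
    from set_borel_integral_eq_integral(2)[OF this] show ?thesis
      by (simp add: set_lebesgue_integral_def)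
  qed
  finally show ?thesis .
qed


definition cross2 :: "real^2 \<Rightarrow> real^2 \<Rightarrow> real" where
  "cross2 v w = v $ 1 * w $ 2 - v $ 2 * w $ 1"

text \<open>
  The affine map sending \<open>0\<close> and the two unit vectors to \<open>a\<close>, \<open>b\<close>, \<open>c\<close> turns the derivative in direction
  \<open>b - a\<close> into the first partial derivative, and sends the hypotenuse and the vertical leg to the sides
  \<open>bc\<close> and \<open>ac\<close>.
\<close>

lemma integral_triangle_edge_derivative:
  fixes a b c :: "real^2" and f :: "real^2 \<Rightarrow> real" and G :: "real^2 \<Rightarrow> real^2"
  assumes det: "cross2 (b - a) (c - a) \<noteq> 0"
    and f: "\<And>x. (f has_derivative (\<lambda>v. G x \<bullet> v)) (at x)"
    and G: "continuous_on UNIV G"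
  shows "integral (convex hull {a, b, c}) (\<lambda>x. G x \<bullet> (b - a)) =
    \<bar>cross2 (b - a) (c - a)\<bar> * integral {0..1} (\<lambda>t. f (linepath b c t) - f (linepath a c t))"
proof -
  define g where "g = (\<lambda>x::real^2. a + x $ 1 *\<^sub>R (b - a) + x $ 2 *\<^sub>R (c - a))"
  define g' where "g' = (\<lambda>x::real^2. x $ 1 *\<^sub>R (b - a) + x $ 2 *\<^sub>R (c - a))"
  have hull: "convex hull {a, b, c} = g ` std_triangle"
  proof -
    have "{a + u *\<^sub>R (b - a) + v *\<^sub>R (c - a) |u v. 0 \<le> u \<and> 0 \<le> v \<and> u + v \<le> 1} \<subseteq> g ` std_triangle"
    proof clarify
      fix u v :: real assume "0 \<le> u" "0 \<le> v" "u + v \<le> 1"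
      then show "a + u *\<^sub>R (b - a) + v *\<^sub>R (c - a) \<in> g ` std_triangle"
        by (intro image_eqI[of _ _ "vector [u, v]"]) (auto simp: g_def std_triangle_def)
    qed
    then show ?thesis
      unfolding convex_hull_3_alt by (auto simp: g_def std_triangle_def)
  qed
  have g: "(g has_derivative g') (at x within S)" for x S
    unfolding g_def g'_def
    by (auto intro!: derivative_eq_intros bounded_linear.has_derivative[OF bounded_linear_vec_nth])
  have cg: "continuous_on S g" for S
    using g by (meson has_derivative_continuous_on)
  have det_g': "det (matrix g') = cross2 (b - a) (c - a)"
    by (simp add: det_2 matrix_def g'_def axis_def cross2_def)
  \<comment> \<open>Cramer's rule: pairing with one side in the determinant isolates the other coefficient.\<close>
  have inj: "inj_on g std_triangle"
  proof (rule inj_onI)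
    fix x y assume "g x = g y"
    then have e: "(x $ 1 - y $ 1) *\<^sub>R (b - a) + (x $ 2 - y $ 2) *\<^sub>R (c - a) = 0"
      by (simp add: g_def algebra_simps)
    have "cross2 ((x $ 1 - y $ 1) *\<^sub>R (b - a) + (x $ 2 - y $ 2) *\<^sub>R (c - a)) (c - a) = 0"
      "cross2 (b - a) ((x $ 1 - y $ 1) *\<^sub>R (b - a) + (x $ 2 - y $ 2) *\<^sub>R (c - a)) = 0"
      unfolding e by (simp_all add: cross2_def)
    then have "(x $ 1 - y $ 1) * cross2 (b - a) (c - a) = 0" "(x $ 2 - y $ 2) * cross2 (b - a) (c - a) = 0"
      by (simp_all add: cross2_def algebra_simps)
    then show "x = y"
      using det by (simp add: vec_eq_iff forall_2)
  qed
  have cf: "continuous_on UNIV f"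
    using f by (meson has_derivative_continuous_on has_derivative_at_withinI)
  have int_G: "G absolutely_integrable_on g ` std_triangle"
    by (intro absolutely_integrable_continuous_compact compact_continuous_image compact_std_triangle cg
        continuous_on_subset[OF G]) simp
  have int_Gg: "(\<lambda>x. \<bar>det (matrix g')\<bar> *\<^sub>R G (g x)) absolutely_integrable_on std_triangle"
    by (intro absolutely_integrable_continuous_compact compact_std_triangle continuous_intros
        continuous_on_compose2[OF G cg]) simp
  have "integral (convex hull {a, b, c}) (\<lambda>x. G x \<bullet> (b - a)) = integral (g ` std_triangle) G \<bullet> (b - a)"
    unfolding hull
    using integral_linear[OF int_G[THEN set_lebesgue_integral_eq_integral(1)] bounded_linear_inner_left, of "b - a"]
    by (simp only: o_def)
  also have "integral (g ` std_triangle) G = integral std_triangle (\<lambda>x. \<bar>det (matrix g')\<bar> *\<^sub>R G (g x))"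
    using compact_std_triangle g inj int_G
    by (intro integral_change_of_variables) (auto simp: fmeasurableD lmeasurable_compact)
  also have "\<dots> \<bullet> (b - a) = integral std_triangle (\<lambda>x. \<bar>det (matrix g')\<bar> *\<^sub>R G (g x) \<bullet> (b - a))"
    using integral_linear[OF int_Gg[THEN set_lebesgue_integral_eq_integral(1)] bounded_linear_inner_left, of "b - a"]
    by (simp only: o_def)
  also have "\<dots> = \<bar>cross2 (b - a) (c - a)\<bar> * integral std_triangle (\<lambda>x. G (g x) \<bullet> (b - a))"
    by (simp add: det_g')
  also have "integral std_triangle (\<lambda>x. G (g x) \<bullet> (b - a)) =
      integral {0..1} (\<lambda>t. f (g (vector [1 - t, t])) - f (g (vector [0, t])))"
  proof (rule integral_std_triangle[where f = "\<lambda>x. f (g x)"])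
    show "((\<lambda>s. f (g (vector [s, t]))) has_real_derivative G (g (vector [s, t])) \<bullet> (b - a)) (at s)" for s t
    proof -
      have "((\<lambda>s. g (vector [s, t])) has_derivative (\<lambda>h. h *\<^sub>R (b - a))) (at s)"
        unfolding g_def by (auto intro!: derivative_eq_intros)
      from has_derivative_compose[OF this f] show ?thesis
        by (simp add: has_field_derivative_def mult_commute_abs)
    qed
  qed (auto intro!: continuous_intros continuous_on_compose2[OF G cg] continuous_on_compose2[OF cf cg])
  also have "(\<lambda>t. f (g (vector [1 - t, t])) - f (g (vector [0, t]))) = (\<lambda>t. f (linepath b c t) - f (linepath a c t))"
  proof -
    have "g (vector [1 - t, t]) = linepath b c t" "g (vector [0, t]) = linepath a c t" for t
      by (simp_all add: g_def linepath_def vec_eq_iff algebra_simps)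
    then show ?thesis by simp
  qed
  finally show ?thesis .
qed

section \<open>The gradient theorem on a triangle\<close>

definition perp :: "real^2 \<Rightarrow> real^2" where
  "perp v = vector [- v $ 2, v $ 1]"

lemma perp_inner: "perp v \<bullet> w = cross2 v w"
  by (simp add: perp_def cross2_def inner_vec_def sum_2)

lemma norm_perp [simp]: "norm (perp v) = norm v"
  by (simp add: perp_def norm_vec_def L2_set_def sum_2 add.commute)

lemma perp_decomposition: "(v \<bullet> v) *\<^sub>R n = (n \<bullet> v) *\<^sub>R v + (perp v \<bullet> n) *\<^sub>R perp v"
  by (simp add: vec_eq_iff forall_2 perp_def inner_vec_def sum_2 algebra_simps)

text \<open>
  Lagrange's identity: a vanishing determinant is the equality case of the Cauchy-Schwarz inequality.
\<close>

lemma cross2_nonzero: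
  assumes "\<not> affine_dependent {a, b, c}" "a \<noteq> b" "a \<noteq> c" "b \<noteq> c"
  shows "cross2 (b - a) (c - a) \<noteq> 0"
proof
  assume 0: "cross2 (b - a) (c - a) = 0"
  define v w where "v = b - a" and "w = c - a"
  have "(v \<bullet> w)\<^sup>2 = (v \<bullet> v) * (w \<bullet> w) - (cross2 v w)\<^sup>2"
    by (simp add: cross2_def inner_vec_def sum_2 power2_eq_square algebra_simps)
  then have "\<bar>v \<bullet> w\<bar>\<^sup>2 = (norm v * norm w)\<^sup>2"
    using 0 by (simp add: v_def w_def power_mult_distrib power2_norm_eq_inner)
  then have "\<bar>v \<bullet> w\<bar> = norm v * norm w"
    by (subst (asm) power2_eq_iff_nonneg) auto
  then have "collinear {0, b - a, c - a}"
    by (simp add: norm_cauchy_schwarz_equal v_def w_def)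
  then have "collinear {b, a, c}"
    by (simp add: collinear_3[of b a c])
  then show False
    using assms by (simp add: collinear_3_eq_affine_dependent insert_commute)
qed

lemma edges_triangle:
  fixes a b c :: "real^2"
  assumes ind: "\<not> affine_dependent {a, b, c}" and ne: "a \<noteq> b" "a \<noteq> c" "b \<noteq> c"
  shows "edges (convex hull {a, b, c}) = {closed_segment a b, closed_segment b c, closed_segment c a}"
proof -
  have edge_iff: "e edge_of convex hull {a, b, c} \<longleftrightarrow>
      (\<exists>V. (V \<subseteq> {a, b, c} \<and> card V = 2) \<and> e = convex hull V)" for e
  proof -
    have "aff_dim V = int (card V) - 1" if "V \<subseteq> {a, b, c}" for V
      using aff_dim_affine_independent[OF affine_independent_subset[OF ind that]] by simp
    then show ?thesis
      by (auto simp: edge_of_def face_of_convex_hull_affine_independent[OF ind] aff_dim_convex_hull)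
  qed
  have pair_iff: "V \<subseteq> {a, b, c} \<and> card V = 2 \<longleftrightarrow> V = {a, b} \<or> V = {b, c} \<or> V = {c, a}" for V
  proof
    assume V: "V \<subseteq> {a, b, c} \<and> card V = 2"
    then obtain x y where "V = {x, y}" "x \<noteq> y"
      by (auto simp: card_2_iff)
    moreover from this V have "x = a \<or> x = b \<or> x = c" "y = a \<or> y = b \<or> y = c"
      by simp_all
    ultimately show "V = {a, b} \<or> V = {b, c} \<or> V = {c, a}"
      by (elim disjE) (simp_all add: insert_commute)
  next
    assume "V = {a, b} \<or> V = {b, c} \<or> V = {c, a}"
    with ne show "V \<subseteq> {a, b, c} \<and> card V = 2"
      by (elim disjE) simp_all
  qed
  show ?thesis
    unfolding edges_def edge_iff pair_iff segment_convex_hull by blast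
qed

text \<open>
  The defining condition on a normal \<open>m\<close> is linear, so it need only be tested at the vertices: \<open>m\<close> is
  orthogonal to the side and points away from \<open>r\<close>. The factor \<open>dist p q\<close> is the one produced by the edge
  integral; with it the right-hand side is free of square roots.
\<close>

lemma outward_normal_triangle:
  fixes p q r :: "real^2"
  assumes det: "cross2 (q - p) (r - p) \<noteq> 0"
  shows "dist p q *\<^sub>R outward_normal (convex hull {p, q, r}) (closed_segment p q) =
    - sgn (cross2 (q - p) (r - p)) *\<^sub>R perp (q - p)"
proof -
  define w d where "w = q - p" and "d = cross2 w (r - p)"
  have d: "d \<noteq> 0" and w: "w \<noteq> 0"
    using det by (auto simp: d_def w_def cross2_def)
  define n where "n = - (sgn d / norm w) *\<^sub>R perp w"
  have outward: "(\<forall>x\<in>closed_segment p q. \<forall>y\<in>convex hull {p, q, r}. m \<bullet> y \<le> m \<bullet> x) \<longleftrightarrow>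
      m \<bullet> w = 0 \<and> m \<bullet> (r - p) \<le> 0" (is "?L \<longleftrightarrow> ?R") for m
  proof
    assume ?L
    moreover have "p \<in> closed_segment p q" "q \<in> closed_segment p q"
      "p \<in> convex hull {p, q, r}" "q \<in> convex hull {p, q, r}" "r \<in> convex hull {p, q, r}"
      by (auto intro: hull_inc)
    ultimately have "m \<bullet> p \<le> m \<bullet> q" "m \<bullet> q \<le> m \<bullet> p" "m \<bullet> r \<le> m \<bullet> p"
      by blast+
    then show ?R
      by (simp add: w_def inner_diff_right)
  next
    assume R: ?R
    have on_edge: "m \<bullet> x = m \<bullet> p" if x: "x \<in> closed_segment p q" for x
    proof -
      obtain u where "x = (1 - u) *\<^sub>R p + u *\<^sub>R q"
        using x unfolding in_segment by blast
      then have "x = p + u *\<^sub>R w"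
        by (simp add: w_def algebra_simps)
      then show ?thesis
        using R by (simp add: inner_add_right)
    qed
    have in_triangle: "m \<bullet> y \<le> m \<bullet> p" if y_in: "y \<in> convex hull {p, q, r}" for y
    proof -
      obtain u v where y: "y = p + u *\<^sub>R (q - p) + v *\<^sub>R (r - p)" and "0 \<le> v"
        using y_in unfolding convex_hull_3_alt by blast
      moreover have "v * (m \<bullet> (r - p)) \<le> 0"
        using R \<open>0 \<le> v\<close> by (simp add: mult_nonneg_nonpos)
      ultimately show ?thesis
        using R by (simp add: w_def inner_add_right)
    qed
    show ?L
    proof (intro ballI)
      fix x y assume "x \<in> closed_segment p q" "y \<in> convex hull {p, q, r}"
      then show "m \<bullet> y \<le> m \<bullet> x"
        using in_triangle[of y] on_edge[of x] by argo
    qed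
  qed
  have "outward_normal (convex hull {p, q, r}) (closed_segment p q) = n"
    unfolding outward_normal_def outward
  proof (rule the_equality)
    have "n \<bullet> w = 0"
      by (simp add: n_def perp_inner cross2_def)
    moreover have "n \<bullet> (r - p) \<le> 0"
      by (simp add: n_def perp_inner d_def[symmetric] sgn_mult_self_eq abs_sgn[symmetric] mult.commute)
    ultimately show "norm n = 1 \<and> n \<bullet> w = 0 \<and> n \<bullet> (r - p) \<le> 0"
      using w d by (simp add: n_def abs_sgn_eq)
  next
    fix m assume m: "norm m = 1 \<and> m \<bullet> w = 0 \<and> m \<bullet> (r - p) \<le> 0"
    define \<mu> where "\<mu> = (perp w \<bullet> m) / (w \<bullet> w)"
    have "(w \<bullet> w) *\<^sub>R m = (w \<bullet> w) *\<^sub>R (\<mu> *\<^sub>R perp w)"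
      using perp_decomposition[of w m] m w by (simp add: \<mu>_def)
    then have m_eq: "m = \<mu> *\<^sub>R perp w"
      using w by (simp only: scaleR_cancel_left inner_eq_zero_iff) simp
    have "\<bar>\<mu>\<bar> * norm w = 1"
      using m by (simp add: m_eq)
    moreover have "\<mu> * d \<le> 0"
      using m by (simp add: m_eq perp_inner d_def)
    ultimately have "\<mu> = - (sgn d / norm w)"
      using w d by (cases "d > 0"; cases "\<mu> > 0") (auto simp: field_simps mult_le_0_iff sgn_if)
    then show "m = n"
      by (simp add: m_eq n_def)
  qed
  then show ?thesis
    using w by (simp add: n_def w_def d_def dist_norm norm_minus_commute)
qed

lemma integral_reverse_unit:
  fixes g :: "real \<Rightarrow> 'a::real_normed_vector"
  shows "integral {0..1} (\<lambda>t. g (1 - t)) = integral {0..1} g"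
proof -
  have *: "((\<lambda>t. g (1 - t)) has_integral i) {0..1}" if "(g has_integral i) {0..1}" for g :: "real \<Rightarrow> 'a" and i
    using has_integral_affinity[of g i 0 1 "-1" 1] that
    by (simp add: image_affinity_atLeastAtMost)
  have "((\<lambda>t. g (1 - t)) has_integral i) {0..1} \<longleftrightarrow> (g has_integral i) {0..1}" for i
    using *[of g i] *[of "\<lambda>t. g (1 - t)" i] by auto
  then show ?thesis
    by (simp add: integral_def integrable_on_def)
qed

text \<open>
  A segment determines its end points only up to order, so the choice made in
  \<^const>\<open>edge_integral\<close> is \<open>(p, q)\<close> or \<open>(q, p)\<close>; reversing the parametrization makes both agree.
\<close>

lemma edge_integral_closed_segment:
  "edge_integral (closed_segment p q) f = dist p q *\<^sub>R integral {0..1} (\<lambda>t. f (linepath p q t))"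
proof -
  define s where "s = (SOME (p', q'). closed_segment p q = closed_segment p' q')"
  have "case s of (p', q') \<Rightarrow> closed_segment p q = closed_segment p' q'"
    unfolding s_def by (rule someI[of _ "(p, q)"]) simp
  then have "s = (p, q) \<or> s = (q, p)"
    by (auto simp: doubleton_eq_iff)
  moreover have "integral {0..1} (\<lambda>t. f (linepath q p t)) = integral {0..1} (\<lambda>t. f (linepath p q t))"
    using integral_reverse_unit[of "\<lambda>t. f (linepath p q t)"]
    by (simp add: linepath_def algebra_simps)
  ultimately show ?thesis
    unfolding edge_integral_def s_def[symmetric] by (auto simp: dist_commute)
qed

lemma edge_integral_cong:
  assumes "\<And>x. x \<in> closed_segment p q \<Longrightarrow> f x = g x"
  shows "edge_integral (closed_segment p q) f = edge_integral (closed_segment p q) g"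
  unfolding edge_integral_closed_segment
  using assms by (intro arg_cong2[where f="scaleR"] integral_cong) (auto simp: linepath_in_path)

lemma edge_integral_linear:
  fixes f :: "point \<Rightarrow> 'a::banach" and h :: "'a \<Rightarrow> 'b::real_normed_vector"
  assumes f: "continuous_on UNIV f" and h: "bounded_linear h"
  shows "edge_integral (closed_segment p q) (\<lambda>x. h (f x)) = h (edge_integral (closed_segment p q) f)"
proof -
  have "(\<lambda>t. f (linepath p q t)) integrable_on {0..1}"
    by (intro integrable_continuous_real continuous_on_compose2[OF f] continuous_on_linepath) simp
  from integral_linear[OF this h] show ?thesis
    unfolding edge_integral_closed_segment by (simp add: o_def linear_simps[OF h])
qed

lemma triangle_vertices:
  fixes K :: "'a::euclidean_space set"
  assumes "2 simplex K"
  obtains a b c where "\<not> affine_dependent {a, b, c}" "a \<noteq> b" "a \<noteq> c" "b \<noteq> c" "K = convex hull {a, b, c}"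
proof -
  obtain V where "\<not> affine_dependent V" "card V = 3" "K = convex hull V"
    using assms by (auto simp: simplex_def)
  with that show ?thesis
    by (auto simp: card_3_iff)
qed

lemma edge_is_segment:
  assumes "2 simplex K" "e \<in> edges K"
  shows "\<exists>p q. e = closed_segment p q"
  using assms by (metis triangle_vertices edges_triangle insertE singletonD)

text \<open>
  Both sides are vectors of the plane, so it suffices to compare their inner products with \<open>b - a\<close> and
  \<open>c - a\<close>. The side parallel to the test vector contributes nothing, and the other two contribute
  their edge means with weights \<open>\<plusminus> \<bar>d\<bar>\<close>, matching \<open>integral_triangle_edge_derivative\<close>.
\<close>

theorem gradient_theorem_triangle:
  fixes f :: "real^2 \<Rightarrow> real" and G :: "real^2 \<Rightarrow> real^2"
  assumes K: "2 simplex K"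
    and f: "\<And>x. (f has_derivative (\<lambda>v. G x \<bullet> v)) (at x)"
    and G: "continuous_on UNIV G"
  shows "(G has_integral (\<Sum>e\<in>edges K. edge_integral e f *\<^sub>R outward_normal K e)) K"
proof -
  obtain a b c where abc: "\<not> affine_dependent {a, b, c}" "a \<noteq> b" "a \<noteq> c" "b \<noteq> c"
    and K_eq: "K = convex hull {a, b, c}"
    using triangle_vertices[OF K] .
  define d where "d = cross2 (b - a) (c - a)"
  have d: "d \<noteq> 0" "cross2 (c - b) (a - b) = d" "cross2 (a - c) (b - c) = d" "cross2 (c - a) (b - a) = - d"
    using cross2_nonzero[OF abc] by (auto simp: d_def cross2_def algebra_simps)
  define I where "I = (\<lambda>p q. integral {0..1} (\<lambda>t. f (linepath p q t)))"
  have cf: "continuous_on UNIV f"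
    using f by (meson has_derivative_continuous_on has_derivative_at_withinI)
  have int_f: "(\<lambda>t. f (linepath p q t)) integrable_on {0..1}" for p q
    by (intro integrable_continuous_real continuous_on_compose2[OF cf] continuous_on_linepath) simp
  have I_sym: "I p q = I q p" for p q
    using integral_reverse_unit[of "\<lambda>t. f (linepath p q t)"]
    by (simp add: I_def linepath_def algebra_simps)
  \<comment> \<open>The boundary sum, with every side traversed in the cyclic order \<open>a\<close>, \<open>b\<close>, \<open>c\<close>.\<close>
  define B where "B = - sgn d *\<^sub>R (I a b *\<^sub>R perp (b - a) + I b c *\<^sub>R perp (c - b) + I c a *\<^sub>R perp (a - c))"
  have "(\<Sum>e\<in>edges K. edge_integral e f *\<^sub>R outward_normal K e) = B"
  proof -
    have edge: "edge_integral (closed_segment p q) f *\<^sub>R outward_normal K (closed_segment p q) =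
        - sgn d *\<^sub>R (I p q *\<^sub>R perp (q - p))"
      if "K = convex hull {p, q, r}" "cross2 (q - p) (r - p) = d" for p q r
    proof -
      have "edge_integral (closed_segment p q) f *\<^sub>R outward_normal K (closed_segment p q) =
          I p q *\<^sub>R (dist p q *\<^sub>R outward_normal K (closed_segment p q))"
        by (simp add: edge_integral_closed_segment I_def mult.commute)
      then show ?thesis
        using outward_normal_triangle[of q p r] that d(1) by simp
    qed
    have "edges K = {closed_segment a b, closed_segment b c, closed_segment c a}"
      using edges_triangle[OF abc] K_eq by simp
    moreover have "closed_segment a b \<noteq> closed_segment b c" "closed_segment a b \<noteq> closed_segment c a"
      "closed_segment b c \<noteq> closed_segment c a"
      using abc by (auto simp: doubleton_eq_iff)
    moreover have "K = convex hull {a, b, c}" "K = convex hull {b, c, a}" "K = convex hull {c, a, b}"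
      by (simp_all add: K_eq insert_commute)
    ultimately show ?thesis
      using edge[of a b c] edge[of b c a] edge[of c a b] d
      by (simp add: B_def d_def scaleR_add_right)
  qed
  moreover have int_G: "G integrable_on K"
    unfolding K_eq
    by (intro set_lebesgue_integral_eq_integral(1) absolutely_integrable_continuous_compact
        finite_imp_compact_convex_hull continuous_on_subset[OF G]) auto
  moreover have "integral K G = B"
  proof -
    have inner: "integral K (\<lambda>x. G x \<bullet> v) = integral K G \<bullet> v" for v
      using integral_linear[OF int_G bounded_linear_inner_left, of v] by (simp add: o_def)
    have "integral K G \<bullet> (b - a) = \<bar>d\<bar> * (I b c - I a c)"
      using integral_triangle_edge_derivative[OF _ f G, of b a c] d(1) inner[of "b - a"] int_f
      by (simp add: d_def[symmetric] K_eq I_def integral_diff)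
    moreover have "B \<bullet> (b - a) = \<bar>d\<bar> * (I b c - I a c)"
    proof -
      have "cross2 (b - a) (b - a) = 0" "cross2 (c - b) (b - a) = - d" "cross2 (a - c) (b - a) = d"
        by (simp_all add: d_def cross2_def algebra_simps)
      then show ?thesis
        unfolding B_def inner_scaleR_left inner_add_left perp_inner I_sym[of c a] abs_sgn[of d]
        by (simp add: algebra_simps)
    qed
    moreover have "integral K G \<bullet> (c - a) = \<bar>d\<bar> * (I b c - I a b)"
      using integral_triangle_edge_derivative[OF _ f G, of c a b] d(1,4) inner[of "c - a"] int_f
      unfolding I_sym[of b c] by (simp add: K_eq I_def integral_diff insert_commute)
    moreover have "B \<bullet> (c - a) = \<bar>d\<bar> * (I b c - I a b)"
    proof -
      have "cross2 (b - a) (c - a) = d" "cross2 (c - b) (c - a) = - d" "cross2 (a - c) (c - a) = 0"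
        by (simp_all add: d_def cross2_def algebra_simps)
      then show ?thesis
        unfolding B_def inner_scaleR_left inner_add_left perp_inner abs_sgn[of d]
        by (simp add: algebra_simps)
    qed
    ultimately have 0: "(integral K G - B) \<bullet> (b - a) = 0" "(integral K G - B) \<bullet> (c - a) = 0"
      by (simp_all add: inner_diff_left)
    \<comment> \<open>\<open>z\<close> is orthogonal to two vectors with determinant \<open>d \<noteq> 0\<close>.\<close>
    define z where "z = integral K G - B"
    have "d *\<^sub>R z = 0"
      using 0 unfolding z_def[symmetric] by (simp add: vec_eq_iff forall_2 d_def cross2_def inner_vec_def sum_2) algebra
    then show ?thesis
      using d(1) by (simp add: z_def)
  qed
  ultimately show ?thesis
    by (simp add: has_integral_iff)
qed

section \<open>Conformity of the mesh\<close>

text \<open>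
  A point \<open>z\<close> of the relative interior of the edge lies in the open domain, so it is a limit of points of
  the domain outside \<open>K\<close>. These are covered by the other elements, finitely many closed sets, so
  one of those contains \<open>z\<close>. It meets \<open>K\<close> in a face, and a face containing a relative interior point of
  the edge contains the whole edge.
\<close>

lemma neighbour_shares_edge:
  assumes mesh: "triangular_mesh \<T> \<Omega>" and K: "K \<in> \<T>" and e: "e \<in> edges K"
    and inner: "\<not> e \<subseteq> frontier \<Omega>"
  shows "neighbour \<T> K e \<in> \<T>" "e edge_of neighbour \<T> K e"
proof -
  have \<Omega>: "open \<Omega>" "\<Union>\<T> = closure \<Omega>" and fin: "finite \<T>" and simp2: "\<And>K. K \<in> \<T> \<Longrightarrow> 2 simplex K"
    and face: "\<And>K K'. K \<in> \<T> \<Longrightarrow> K' \<in> \<T> \<Longrightarrow> K \<inter> K' face_of K"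
    using mesh by (auto simp: triangular_mesh_def triangulation_def)
  have eK: "e face_of K" and dim_e: "aff_dim e = 1"
    using e by (auto simp: edges_def edge_of_def)
  have dim_K: "aff_dim K = 2"
    using simp2[OF K] by (rule aff_dim_simplex)
  have "\<exists>x\<in>e. x \<in> \<Omega>"
    using inner eK K \<Omega> by (force simp: frontier_def interior_open dest: face_of_imp_subset)
  moreover have "e \<subseteq> closure (rel_interior e)"
    using convex_closure_rel_interior[OF face_of_imp_convex[OF eK]] closure_subset by blast
  ultimately obtain z where z: "z \<in> rel_interior e" "z \<in> \<Omega>"
    using open_Int_closure_eq_empty[OF \<Omega>(1), of "rel_interior e"] by blast
  have "z \<in> e"
    using z rel_interior_subset by blast
  have "e \<noteq> K"
    using dim_e dim_K by auto
  then have "z \<notin> interior K"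
    using face_of_disjoint_interior[OF eK] \<open>z \<in> e\<close> by blast
  then have "z \<in> \<Omega> \<inter> closure (- K)"
    using z by (simp add: closure_complement)
  then have "z \<in> closure (\<Omega> \<inter> - K)"
    using open_Int_closure_subset[OF \<Omega>(1)] by blast
  moreover have "\<Omega> \<inter> - K \<subseteq> \<Union>(\<T> - {K})"
    using \<Omega>(2) closure_subset by blast
  moreover have "closed (\<Union>(\<T> - {K}))"
    using fin simp2 by (intro closed_Union) (auto intro: closed_simplex)
  ultimately have "z \<in> \<Union>(\<T> - {K})"
    using closure_minimal by blast
  then obtain K' where K': "K' \<in> \<T>" "K' \<noteq> K" "z \<in> K'"
    by blast
  have "e \<subseteq> K \<inter> K'"
    using z \<open>z \<in> e\<close> K' face_of_imp_subset[OF eK]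
    by (intro subset_of_face_of[OF face[OF K K'(1)]]) auto
  then have "e face_of K \<inter> K'"
    by (intro face_of_subset[OF eK]) auto
  then have "e face_of K'"
    using face[OF K'(1) K] by (metis face_of_trans inf_commute)
  then have "\<exists>K'. K' \<in> \<T> \<and> K' \<noteq> K \<and> e edge_of K'"
    using K' dim_e by (auto simp: edge_of_def)
  from someI_ex[OF this]
  show "neighbour \<T> K e \<in> \<T>" "e edge_of neighbour \<T> K e"
    by (simp_all add: neighbour_def)
qed

section \<open>Gradients of polynomials\<close>

text \<open>
  The regularity of polynomials needed for the gradient theorem: continuous differentiability on
  the plane with an explicit gradient, closed under sums and products.
\<close>

definition has_cont_grad :: "(real^2 \<Rightarrow> real) \<Rightarrow> (real^2 \<Rightarrow> real^2) \<Rightarrow> bool" where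
  "has_cont_grad f G \<longleftrightarrow>
     continuous_on UNIV G \<and> (\<forall>x. (f has_derivative (\<lambda>v. G x \<bullet> v)) (at x))"

lemma has_cont_grad_continuous: "has_cont_grad f G \<Longrightarrow> continuous_on UNIV f"
  unfolding has_cont_grad_def by (meson has_derivative_continuous_on has_derivative_at_withinI)

lemma has_cont_grad_const: "has_cont_grad (\<lambda>x. c) (\<lambda>x. 0)"
  by (simp add: has_cont_grad_def)

lemma has_cont_grad_coordinate: "has_cont_grad (\<lambda>x. x $ i) (\<lambda>x. axis i 1)"
  by (simp add: has_cont_grad_def inner_axis' bounded_linear.has_derivative[OF bounded_linear_vec_nth])

lemma has_cont_grad_add:
  "has_cont_grad f F \<Longrightarrow> has_cont_grad g G \<Longrightarrow> has_cont_grad (\<lambda>x. f x + g x) (\<lambda>x. F x + G x)"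
  by (auto simp: has_cont_grad_def inner_add_left intro!: continuous_intros derivative_eq_intros)

lemma has_cont_grad_mult:
  assumes "has_cont_grad f F" "has_cont_grad g G"
  shows "has_cont_grad (\<lambda>x. f x * g x) (\<lambda>x. f x *\<^sub>R G x + g x *\<^sub>R F x)"
  using assms has_cont_grad_continuous[OF assms(1)] has_cont_grad_continuous[OF assms(2)]
  by (auto simp: has_cont_grad_def inner_add_left mult.commute intro!: continuous_intros derivative_eq_intros)

lemma has_cont_grad_sum:
  assumes "\<And>i. i \<in> I \<Longrightarrow> \<exists>G. has_cont_grad (f i) G"
  shows "\<exists>G. has_cont_grad (\<lambda>x. \<Sum>i\<in>I. f i x) G"
  using assms
proof (induction I rule: infinite_finite_induct)
  case (insert i I)
  then show ?case
  proof -
    obtain F G where "has_cont_grad (f i) F" "has_cont_grad (\<lambda>x. \<Sum>i\<in>I. f i x) G"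
      using insert by blast
    then show ?thesis
      using insert.hyps by (auto intro: has_cont_grad_add)
  qed
qed (auto intro: has_cont_grad_const)

lemma has_cont_grad_power:
  assumes "\<exists>G. has_cont_grad f G"
  shows "\<exists>G. has_cont_grad (\<lambda>x. f x ^ n) G"
proof (induction n)
  case (Suc n)
  with assms show ?case
    unfolding power_Suc using has_cont_grad_mult[of f _ "\<lambda>x. f x ^ n"] by fast
qed (auto intro: has_cont_grad_const)

lemma has_cont_grad_grad_eq:
  assumes "has_cont_grad f G"
  shows "grad f = G"
proof
  fix x
  have "frechet_derivative f (at x) = (\<lambda>v. G x \<bullet> v)"
    using assms by (auto simp: has_cont_grad_def intro: frechet_derivative_at[symmetric])
  then show "grad f x = G x"
    by (simp add: grad_def inner_axis)
qed

lemma polys_has_cont_grad: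
  assumes "p \<in> polys k"
  shows "has_cont_grad p (grad p)"
proof -
  obtain c :: "nat \<Rightarrow> nat \<Rightarrow> real"
    where "\<forall>x. p x = (\<Sum>i\<le>k. \<Sum>j\<le>k - i. c i j * (x $ 1) ^ i * (x $ 2) ^ j)"
    using assms by (auto simp: polys_def)
  then have p: "p = (\<lambda>x. \<Sum>i\<le>k. \<Sum>j\<le>k - i. c i j * (x $ 1) ^ i * (x $ 2) ^ j)"
    by auto
  have "\<exists>G. has_cont_grad (\<lambda>x. c i j * (x $ 1) ^ i * (x $ 2) ^ j) G" for i j
  proof -
    obtain F G where "has_cont_grad (\<lambda>x. (x $ 1) ^ i) F" "has_cont_grad (\<lambda>x. (x $ 2) ^ j) G"
      using has_cont_grad_power has_cont_grad_coordinate by meson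
    then show ?thesis
      by (intro exI) (rule has_cont_grad_mult has_cont_grad_const | assumption)+
  qed
  then have "\<exists>G. has_cont_grad p G"
    unfolding p by (intro has_cont_grad_sum)
  then show ?thesis
    using has_cont_grad_grad_eq by metis
qed

section \<open>Fluxes at rest\<close>

text \<open>
  The embedding of the plane as the two momentum components of the state space. At rest, all
  terms of the residual lie in its image, so the residual is the image of one planar vector.
\<close>

definition momentum :: "real^2 \<Rightarrow> state" where
  "momentum v = vector [0, v $ 1, v $ 2, 0]"

lemma bounded_linear_momentum: "bounded_linear momentum"
  unfolding linear_conv_bounded_linear[symmetric]
  by (rule linearI) (simp_all add: momentum_def vec_eq_iff forall_4 vector_4)

lemma scaleR_momentum: "c *\<^sub>R momentum v = momentum (c *\<^sub>R v)"
  by (simp add: linear_simps[OF bounded_linear_momentum])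

lemma flux_no_momentum:
  assumes "U $ 2 = 0" "U $ 3 = 0"
  shows "flux D U *v n = momentum ((1/2 * gravity D * U $ 4 * U $ 1) *\<^sub>R n)"
  using assms
  by (simp add: flux_def Let_def momentum_def vec_eq_iff forall_4 vector_4 matrix_vector_mult_def
      sum_2 vel_u_def vel_v_def)

lemma flux_at_rest:
  assumes "at_rest C1 C2 U b"
  shows "flux D U *v n = momentum ((1/2 * gravity D * C1 * (C2 - b)\<^sup>2) *\<^sub>R n)"
proof -
  have U: "U $ 1 = C2 - b"
    using assms by (simp add: at_rest_def algebra_simps)
  show ?thesis
    using assms flux_no_momentum[of U D n] U
    by (simp add: at_rest_def power2_eq_square mult.assoc)
qed

lemma source_at_rest:
  assumes "at_rest C1 C2 U b"
  shows "source D U v = momentum (- (gravity D * C1 * (C2 - b)) *\<^sub>R v)"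
proof -
  have U: "U $ 1 = C2 - b"
    using assms by (simp add: at_rest_def algebra_simps)
  with assms show ?thesis
    by (simp add: at_rest_def source_def momentum_def vec_eq_iff forall_4 vector_4 mult.assoc)
qed

text \<open>
  The right-hand side depends on \<open>b_star\<close> alone, so it is the same for the interior and the exterior
  values. At a dry point, where the temperature is the default value and may differ from \<open>C1\<close>, the
  hypothesis \<open>b \<le> b_star\<close> makes the reconstructed depth vanish.
\<close>

lemma reconstruct_at_rest:
  assumes "at_rest C1 C2 U b" and "b \<le> b_star"
  shows "reconstruct D b_star b U = max 0 (C2 - b_star) *\<^sub>R vector [1, 0, 0, C1]"
proof (cases "U $ 1 = 0")
  case True
  then show ?thesis
    using assms by (simp add: reconstruct_def at_rest_def)
next
  case False
  then have "U $ 1 + b - b_star = C2 - b_star" "temp D U = C1" "vel_u U = 0" "vel_v U = 0"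
    using assms by (simp_all add: at_rest_def temp_def vel_u_def vel_v_def)
  then show ?thesis
    by (simp add: reconstruct_def)
qed

lemma lax_friedrichs_consistent: "lax_friedrichs D \<alpha> n U U = flux D U *v n"
proof -
  have "(flux D U + flux D U) *v n = flux D U *v n + flux D U *v n"
    by (rule matrix_vector_mult_add_rdistrib)
  then show ?thesis
    by (simp add: lax_friedrichs_def scaleR_half_double del: mult_2)
qed

text \<open>
  Both reconstructed states are the same state, so the numerical flux is the physical flux of that
  state, which the correction term replaces by the flux of the interior state.
\<close>

lemma modified_flux_at_rest:
  assumes "at_rest C1 C2 (U K x) (b K x)"
    and "at_rest C1 C2 (state_ext D U K e x) (bottom_ext D b K e x)"
  shows "modified_flux D U b K e x = flux D (U K x) *v outward_normal K e"
proof -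
  have "state_int_star D U b K e x = state_ext_star D U b K e x"
    using assms
    by (simp add: state_int_star_def state_ext_star_def bottom_star_def reconstruct_at_rest)
  then show ?thesis
    by (simp add: modified_flux_def lax_friedrichs_consistent matrix_vector_mult_diff_rdistrib)
qed

section \<open>The residual at rest\<close>

lemma exterior_at_rest:
  assumes "triangular_mesh (mesh D) (region D)" "lake_at_rest D C1 C2 U b" "boundary_at_rest D C1 C2 U"
    and "K \<in> mesh D" "e \<in> edges K" "x \<in> e"
  shows "at_rest C1 C2 (state_ext D U K e x) (bottom_ext D b K e x)"
proof (cases "e \<subseteq> frontier (region D)")
  case True
  then show ?thesis
    using assms by (simp add: state_ext_def bottom_ext_def boundary_at_rest_def)
next
  case False
  note neighbour = neighbour_shares_edge[OF assms(1,4,5) False]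
  then have "x \<in> neighbour (mesh D) K e"
    using edge_of_imp_subset assms(6) by blast
  then show ?thesis
    using False neighbour assms(2) by (simp add: state_ext_def bottom_ext_def lake_at_rest_def)
qed

text \<open>
  Volume terms and edge terms are the momentum embeddings of the two sides of the gradient theorem
  for \<open>\<phi> * p\<close>.
\<close>

lemma residual_at_rest:
  assumes mesh: "triangular_mesh (mesh D) (region D)"
    and b: "b \<in> dg_space k (mesh D)"
    and rest: "lake_at_rest D C1 C2 U b" "boundary_at_rest D C1 C2 U"
    and K: "K \<in> mesh D" and \<phi>: "\<phi> \<in> dg_space k (mesh D)"
  shows "residual D U b \<phi> K = 0"
proof -
  have simplex_K: "2 simplex K"
    using mesh K by (simp add: triangular_mesh_def)
  have at_rest: "at_rest C1 C2 (U K x) (b K x)" if "x \<in> K" for x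
    using that rest K by (simp add: lake_at_rest_def)
  have grad_\<phi>: "has_cont_grad (\<phi> K) (grad (\<phi> K))" and grad_b: "has_cont_grad (b K) (grad (b K))"
    using b \<phi> K by (auto simp: dg_space_def intro: polys_has_cont_grad)
  define p where "p = (\<lambda>x. 1/2 * gravity D * C1 * (C2 - b K x)\<^sup>2)"
  \<comment> \<open>\<open>P\<close> is the gradient of the pressure \<open>p\<close>, and also the source term.\<close>
  define P where "P = (\<lambda>x. - (gravity D * C1 * (C2 - b K x)) *\<^sub>R grad (b K) x)"
  have grad_p: "has_cont_grad p P"
    using grad_b has_cont_grad_continuous[OF grad_b]
    by (auto simp: has_cont_grad_def p_def P_def intro!: continuous_intros derivative_eq_intros)
  define f where "f = (\<lambda>x. \<phi> K x * p x)"
  have grad_f: "has_cont_grad f (\<lambda>x. \<phi> K x *\<^sub>R P x + p x *\<^sub>R grad (\<phi> K) x)"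
    unfolding f_def by (rule has_cont_grad_mult[OF grad_\<phi> grad_p])
  note cont = has_cont_grad_continuous[OF grad_\<phi>] has_cont_grad_continuous[OF grad_p]
    grad_\<phi>[unfolded has_cont_grad_def, THEN conjunct1] grad_p[unfolded has_cont_grad_def, THEN conjunct1]
  have int: "G integrable_on K" if "continuous_on UNIV G" for G :: "real^2 \<Rightarrow> real^2"
    using compact_simplex[OF simplex_K] that
    by (intro set_lebesgue_integral_eq_integral(1) absolutely_integrable_continuous_compact)
       (auto intro: continuous_on_subset)
  have int_source: "(\<lambda>x. \<phi> K x *\<^sub>R P x) integrable_on K"
    and int_flux: "(\<lambda>x. p x *\<^sub>R grad (\<phi> K) x) integrable_on K"
    by (intro int continuous_on_scaleR cont)+
  have "integral K (\<lambda>x. \<phi> K x *\<^sub>R source D (U K x) (grad (b K) x)) = integral K (momentum \<circ> (\<lambda>x. \<phi> K x *\<^sub>R P x))"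
    by (intro integral_cong) (simp only: source_at_rest[OF at_rest] scaleR_momentum P_def o_def)
  then have source: "integral K (\<lambda>x. \<phi> K x *\<^sub>R source D (U K x) (grad (b K) x)) =
      momentum (integral K (\<lambda>x. \<phi> K x *\<^sub>R P x))"
    by (simp only: integral_linear[OF int_source bounded_linear_momentum])
  have "integral K (\<lambda>x. flux D (U K x) *v grad (\<phi> K) x) = integral K (momentum \<circ> (\<lambda>x. p x *\<^sub>R grad (\<phi> K) x))"
    by (intro integral_cong) (simp only: flux_at_rest[OF at_rest] p_def o_def)
  then have flux: "integral K (\<lambda>x. flux D (U K x) *v grad (\<phi> K) x) = momentum (integral K (\<lambda>x. p x *\<^sub>R grad (\<phi> K) x))"
    by (simp only: integral_linear[OF int_flux bounded_linear_momentum])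
  have edge: "edge_integral e (\<lambda>x. \<phi> K x *\<^sub>R modified_flux D U b K e x) =
      momentum (edge_integral e f *\<^sub>R outward_normal K e)" if e: "e \<in> edges K" for e
  proof -
    obtain q r where e_eq: "e = closed_segment q r"
      using edge_is_segment[OF simplex_K e] by blast
    have "\<phi> K x *\<^sub>R modified_flux D U b K e x = momentum (f x *\<^sub>R outward_normal K e)" if x: "x \<in> e" for x
    proof -
      have "x \<in> K"
        using x e edge_of_imp_subset by (auto simp: edges_def)
      then have "modified_flux D U b K e x = flux D (U K x) *v outward_normal K e"
        using modified_flux_at_rest at_rest exterior_at_rest[OF mesh rest K e x] by blast
      also have "\<dots> = momentum (p x *\<^sub>R outward_normal K e)"
        unfolding p_def by (rule flux_at_rest[OF at_rest[OF \<open>x \<in> K\<close>]])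
      finally show ?thesis
        by (simp add: scaleR_momentum f_def)
    qed
    then have "edge_integral e (\<lambda>x. \<phi> K x *\<^sub>R modified_flux D U b K e x) =
        edge_integral e (\<lambda>x. momentum (f x *\<^sub>R outward_normal K e))"
      unfolding e_eq by (rule edge_integral_cong)
    also have "\<dots> = momentum (edge_integral e f *\<^sub>R outward_normal K e)"
      unfolding e_eq
      by (rule edge_integral_linear[OF has_cont_grad_continuous[OF grad_f]
            bounded_linear_compose[OF bounded_linear_momentum bounded_linear_scaleR_left]])
    finally show ?thesis .
  qed
  have "((\<lambda>x. \<phi> K x *\<^sub>R P x + p x *\<^sub>R grad (\<phi> K) x) has_integral
      (\<Sum>e\<in>edges K. edge_integral e f *\<^sub>R outward_normal K e)) K"
    using grad_f unfolding has_cont_grad_def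
    by (intro gradient_theorem_triangle[OF simplex_K]) blast+
  then have gradient_theorem: "integral K (\<lambda>x. \<phi> K x *\<^sub>R P x) + integral K (\<lambda>x. p x *\<^sub>R grad (\<phi> K) x) =
      (\<Sum>e\<in>edges K. edge_integral e f *\<^sub>R outward_normal K e)"
    using integral_add[OF int_source int_flux] by (simp add: integral_unique)
  have "residual D U b \<phi> K = momentum (integral K (\<lambda>x. \<phi> K x *\<^sub>R P x)) + momentum (integral K (\<lambda>x. p x *\<^sub>R grad (\<phi> K) x))
      - (\<Sum>e\<in>edges K. momentum (edge_integral e f *\<^sub>R outward_normal K e))"
    unfolding residual_def source flux by (simp add: edge)
  also have "\<dots> = 0"
    using bounded_linear.linear[OF bounded_linear_momentum]
    by (simp add: gradient_theorem linear_sum flip: linear_add)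
  finally show ?thesis .
qed

theorem mainTheorem1:
  fixes D :: setting and k :: nat and C1 C2 :: real
    and b :: "real field" and U :: "state field"
  assumes "gravity D > 0"
    and "triangular_mesh (mesh D) (region D)"
    and "k > 0"
    and "C1 > 0" and "C2 > 0"
    and "b \<in> dg_space k (mesh D)"
    and "U \<in> dg_states k (mesh D)"
    and "lake_at_rest D C1 C2 U b"
    and "boundary_at_rest D C1 C2 U"
  shows "(\<forall>K\<in>mesh D. \<forall>\<phi>\<in>dg_space k (mesh D). residual D U b \<phi> K = 0)
    \<and> (\<forall>I V t. semidiscrete_solution D k b I V \<and> t \<in> I \<and> V t = U \<longrightarrow>
         (\<forall>K\<in>mesh D. \<forall>\<phi>\<in>dg_space k (mesh D).
            ((\<lambda>s. integral K (\<lambda>x. \<phi> K x *\<^sub>R V s K x)) has_vector_derivative 0) (at t within I)))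
    \<and> (\<forall>I. semidiscrete_solution D k b I (\<lambda>t. U))"
proof -
  have residual: "residual D U b \<phi> K = 0" if "K \<in> mesh D" "\<phi> \<in> dg_space k (mesh D)" for K \<phi>
    using residual_at_rest that assms by blast
  moreover have "((\<lambda>s. integral K (\<lambda>x. \<phi> K x *\<^sub>R V s K x)) has_vector_derivative 0) (at t within I)"
    if "semidiscrete_solution D k b I V" "t \<in> I" "V t = U" "K \<in> mesh D" "\<phi> \<in> dg_space k (mesh D)"
    for I V t K \<phi>
  proof -
    have "((\<lambda>s. integral K (\<lambda>x. \<phi> K x *\<^sub>R V s K x))
        has_vector_derivative residual D (V t) b \<phi> K) (at t within I)"
      using that unfolding semidiscrete_solution_def by blast
    with that residual show ?thesis
      by simp
  qed
  moreover have "semidiscrete_solution D k b I (\<lambda>t. U)" for I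
    using assms residual by (simp add: semidiscrete_solution_def)
  ultimately show ?thesis
    by blast
qed

end
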